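(* Let $(g_1,h_1),(g_2,h_2)\in\mathcal{D}^2(f;X)$ be such that $(g_1,h_1)$ weakly dominates $(g_2,h_2)$, i.e. $q=g_2-g_1=h_2-h_1$ is convex on $\widehat X$. If $q$ is $C^2$, then $$V_X(g_2)=V_X(g_1)+V_X(q).$$ Consequently, $$d_X(g_1)\le d_X(g_2),\qquad L_X(g_1)\le L_X(g_2),\qquad D_X(g_1)\le D_X(g_2),$$ and $C_\epsilon(g_1;X)\le C_\epsilon(g_2;X)$ for every $\epsilon>0$. Moreover, on any common support set, the complete lower model generated by $(g_1,h_1)$ is pointwise no smaller than the model generated by $(g_2,h_2)$: for all $a_1,\dots,a_m\in X$ ($m\ge 1$) and all $x\in\widehat X$, $$\max_{1\le i\le m}\{g_1(a_i)+\langle\nabla g_1(a_i),x-a_i\rangle\}-h_1(x)\ \ge\ \max_{1\le i\le m}\{g_2(a_i)+\langle\nabla g_2(a_i),x-a_i\rangle\}-h_2(x).$$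
   Context: $X\subset\mathbb{R}^n$ is compact and full dimensional (its affine hull is $\mathbb{R}^n$), $\widehat X=\operatorname{conv}X$, and $f$ is a real-valued $C^2$ function on an open neighborhood of $\widehat X$. $\mathcal{D}^2(f;X)$ is the set of pairs $(g,h)$ of functions that are $C^2$ on a neighborhood of $\widehat X$, satisfy $f=g-h$ there, and are convex on $\widehat X$ (equivalently, have positive semidefinite Hessians at every point of $\widehat X$). For $g$ that is $C^2$ near $\widehat X$ and convex on $\widehat X$: $V_X(g)=\operatorname{span}\bigl(\bigcup_{z\in\widehat X}\operatorname{range}\nabla^2g(z)\bigr)$; $d_X(g)=\dim V_X(g)$; $L_X(g)=\sup_{z\in\widehat X}\lambda_{\max}(\nabla^2g(z))$; $D_X(g)=\operatorname{diam}(P_{V_X(g)}X)$, where $P_V$ is Euclidean orthogonal projection onto $V$; and $$C_\epsilon(g;X)=\begin{cases}\bigl(1+D_X(g)\sqrt{2L_X(g)/\epsilon}\bigr)^{d_X(g)},&d_X(g)>0,\\1,&d_X(g)=0.\end{cases}$$ *)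

theory Defs
  imports "HOL-Analysis.Analysis"
begin

definition grad :: "(real^'n \<Rightarrow> real) \<Rightarrow> real^'n \<Rightarrow> real^'n" where
  "grad f x = (THE D. GDERIV f x :> D)"

definition hess :: "(real^'n \<Rightarrow> real) \<Rightarrow> real^'n \<Rightarrow> real^'n^'n" where
  "hess f x = jacobian (grad f) (at x)"

definition C2_on :: "(real^'n) set \<Rightarrow> (real^'n \<Rightarrow> real) \<Rightarrow> bool" where
  "C2_on U f \<longleftrightarrow> open U \<and> (\<forall>x\<in>U. f differentiable (at x)) \<and>
     (\<forall>x\<in>U. grad f differentiable (at x)) \<and> continuous_on U (hess f)"

text \<open>Functions are total in HOL; only their values on some open neighbourhood of
  \<open>S\<close> are constrained.\<close>

definition C2_near :: "(real^'n) set \<Rightarrow> (real^'n \<Rightarrow> real) \<Rightarrow> bool" where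
  "C2_near S f \<longleftrightarrow> (\<exists>U. S \<subseteq> U \<and> C2_on U f)"

definition D2 :: "(real^'n \<Rightarrow> real) \<Rightarrow> (real^'n) set \<Rightarrow> ((real^'n \<Rightarrow> real) \<times> (real^'n \<Rightarrow> real)) set" where
  "D2 f X = {(g, h).
     (\<exists>U. convex hull X \<subseteq> U \<and> C2_on U g \<and> C2_on U h \<and> (\<forall>x\<in>U. f x = g x - h x)) \<and>
     convex_on (convex hull X) g \<and> convex_on (convex hull X) h}"

definition V_X :: "(real^'n) set \<Rightarrow> (real^'n \<Rightarrow> real) \<Rightarrow> (real^'n) set" where
  "V_X X g = span (\<Union>z\<in>convex hull X. range (\<lambda>v. hess g z *v v))"

definition d_X :: "(real^'n) set \<Rightarrow> (real^'n \<Rightarrow> real) \<Rightarrow> nat" where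
  "d_X X g = dim (V_X X g)"

text \<open>Largest real eigenvalue; meant for symmetric matrices, which always have one.\<close>

definition lambda_max :: "real^'n^'n \<Rightarrow> real" where
  "lambda_max A = Max {l. \<exists>v. v \<noteq> 0 \<and> A *v v = l *\<^sub>R v}"

definition L_X :: "(real^'n) set \<Rightarrow> (real^'n \<Rightarrow> real) \<Rightarrow> real" where
  "L_X X g = (SUP z\<in>convex hull X. lambda_max (hess g z))"

definition orth_proj :: "(real^'n) set \<Rightarrow> real^'n \<Rightarrow> real^'n" where
  "orth_proj W x = (THE p. p \<in> W \<and> (\<forall>w\<in>W. orthogonal (x - p) w))"

definition D_X :: "(real^'n) set \<Rightarrow> (real^'n \<Rightarrow> real) \<Rightarrow> real" where
  "D_X X g = diameter (orth_proj (V_X X g) ` X)"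

definition C_eps :: "real \<Rightarrow> (real^'n) set \<Rightarrow> (real^'n \<Rightarrow> real) \<Rightarrow> real" where
  "C_eps e X g = (if d_X X g > 0 then (1 + D_X X g * sqrt (2 * L_X X g / e)) ^ d_X X g else 1)"

definition lower_model ::
  "(real^'n \<Rightarrow> real) \<Rightarrow> (real^'n \<Rightarrow> real) \<Rightarrow> nat \<Rightarrow> (nat \<Rightarrow> real^'n) \<Rightarrow> real^'n \<Rightarrow> real" where
  "lower_model g h m a x = (MAX i\<in>{1..m}. g (a i) + grad g (a i) \<bullet> (x - a i)) - h x"

end

(* On a convex set with full affine hull, a differentiable map vanishing there has zero derivative
   at every point, boundary points included; applied to g2 - g1 - q and to its gradient, this
   transfers grad g2 = grad g1 + grad q and hess g2 = hess g1 + hess q from values to derivatives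
   on the hull.  The Hessians A = hess g1 and B = hess q are symmetric and positive semidefinite.
   If w is the component of A v orthogonal to V_X g2, then w . (A + B) w = 0 forces A w = 0 and
   hence w = 0; so V_X g1 and V_X q lie in V_X g2.  The monotonicity of L_X comes from Rayleigh
   quotients, that of D_X from projections being contractions, and the comparison of the lower
   models is the tangent inequality for q. *)
theory Submission
  imports Defs
begin

section \<open>Symmetric positive semidefinite matrices: kernels, eigenvalues, Rayleigh
  quotients\<close>

section \<open>Symmetric matrices\<close>

lemma linear_matrix_vector_mult_left: "linear (\<lambda>A::real^'n^'m. A *v x)"
  by (rule linearI) (simp_all add: matrix_vector_mult_add_rdistrib scaleR_matrix_vector_assoc)

lemma continuous_on_matrix_vector_mult_left [continuous_intros]:
  fixes A :: "'a::topological_space \<Rightarrow> real^'n^'m"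
  assumes "continuous_on S A"
  shows "continuous_on S (\<lambda>z. A z *v x)"
proof -
  have "bounded_linear (\<lambda>A::real^'n^'m. A *v x)"
    using linear_matrix_vector_mult_left linear_conv_bounded_linear by blast
  then show ?thesis
    using assms by (rule bounded_linear.continuous_on)
qed

lemma norm_matrix_vector_mult_le:
  fixes A :: "real^'n^'m"
  shows "norm (A *v x) \<le> real CARD('m) * real CARD('n) * norm A * norm x"
proof -
  have "\<bar>A $ i $ j\<bar> \<le> norm A" for i j
    by (rule order_trans[OF component_le_norm_cart Finite_Cartesian_Product.norm_nth_le])
  then have "onorm ((*v) A) \<le> real CARD('m) * real CARD('n) * norm A"
    by (rule onorm_le_matrix_component)
  then show ?thesis
    by (intro order_trans[OF onorm[OF matrix_vector_mul_bounded_linear]] mult_right_mono) auto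
qed

text \<open>Phrased with inner products rather than a transpose, because its uses move the matrix
  from one factor of an inner product to the other.\<close>

definition self_adjoint :: "real^'n^'n \<Rightarrow> bool" where
  "self_adjoint A \<longleftrightarrow> (\<forall>x y. x \<bullet> (A *v y) = (A *v x) \<bullet> y)"

definition pos_semidef :: "real^'n^'n \<Rightarrow> bool" where
  "pos_semidef A \<longleftrightarrow> (\<forall>x. 0 \<le> x \<bullet> (A *v x))"

text \<open>The quadratic form is minimal at any \<open>x\<close> where it vanishes. If
  \<open>A *v x\<close> were nonzero, a small step from \<open>x\<close> along
  \<open>- A *v x\<close> would decrease the form to first order and make it negative.\<close>

lemma pos_semidef_kernel:
  fixes A :: "real^'n^'n"
  assumes A: "self_adjoint A" "pos_semidef A" and x: "x \<bullet> (A *v x) = 0"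
  shows "A *v x = 0"
proof (rule ccontr)
  define y where "y = A *v x"
  define n where "n = y \<bullet> y"
  define c where "c = y \<bullet> (A *v y)"
  \<comment> \<open>The parabola \<open>t\<^sup>2 * c - 2 * t * n\<close> has its minimum at
    \<open>n / c\<close>; the denominator \<open>c + 1\<close> stays positive when
    \<open>c = 0\<close> and still gives a negative value.\<close>
  define t where "t = n / (c + 1)"
  assume "A *v x \<noteq> 0"
  then have n: "n > 0" by (simp add: n_def y_def)
  have c: "c \<ge> 0" using A by (simp add: c_def pos_semidef_def)
  have "0 \<le> (x - t *\<^sub>R y) \<bullet> (A *v (x - t *\<^sub>R y))"
    using A by (simp add: pos_semidef_def)
  also have "\<dots> = t\<^sup>2 * c - 2 * t * n"
  proof -
    have "x \<bullet> (A *v y) = n" using A by (simp add: self_adjoint_def n_def y_def)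
    moreover have "A *v (x - t *\<^sub>R y) = y - t *\<^sub>R (A *v y)"
      by (simp add: matrix_vector_mult_diff_distrib y_def matrix_vector_mult_scaleR)
    ultimately show ?thesis
      using x by (simp add: inner_diff_left inner_diff_right c_def n_def power2_eq_square right_diff_distrib flip: y_def)
  qed
  also have "\<dots> = t * n * (c / (c + 1) - 2)"
    by (simp add: t_def power2_eq_square algebra_simps)
  also have "\<dots> < 0"
  proof -
    have "c / (c + 1) < 2" using c by (simp add: divide_simps)
    moreover have "t * n > 0" using n c by (simp add: t_def)
    ultimately show ?thesis by (simp add: mult_pos_neg)
  qed
  finally show False by simp
qed

text \<open>Eigenvectors of distinct eigenvalues are orthogonal, so choosing one per eigenvalue
  gives an independent, hence finite, family. Finiteness is what gives the \<open>Max\<close> in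
  \<open>lambda_max\<close> its meaning.\<close>

lemma self_adjoint_finite_eigenvalues:
  fixes A :: "real^'n^'n"
  assumes A: "self_adjoint A"
  shows "finite {l. \<exists>v. v \<noteq> 0 \<and> A *v v = l *\<^sub>R v}" (is "finite ?E")
proof -
  obtain v where v: "\<And>l. l \<in> ?E \<Longrightarrow> v l \<noteq> 0 \<and> A *v v l = l *\<^sub>R v l"
  proof -
    have "\<forall>l\<in>?E. \<exists>v. v \<noteq> 0 \<and> A *v v = l *\<^sub>R v" by blast
    from bchoice[OF this] show ?thesis using that by blast
  qed
  have orth: "orthogonal (v l) (v k)" if "l \<in> ?E" "k \<in> ?E" "l \<noteq> k" for l k
  proof -
    have "v l \<bullet> (A *v v k) = (A *v v l) \<bullet> v k"
      using A by (simp add: self_adjoint_def)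
    then have "(k - l) * (v l \<bullet> v k) = 0"
      using v[OF that(1)] v[OF that(2)] by (simp add: algebra_simps)
    then show ?thesis using that by (simp add: orthogonal_def)
  qed
  have "inj_on v ?E"
  proof (rule inj_onI, rule ccontr)
    fix l k assume lk: "l \<in> ?E" "k \<in> ?E" "v l = v k" "l \<noteq> k"
    then have "orthogonal (v l) (v l)" using orth[of l k] by simp
    then show False using v[OF lk(1)] by (simp add: orthogonal_self)
  qed
  moreover have "finite (v ` ?E)"
  proof (rule finiteI_independent, rule pairwise_orthogonal_independent)
    show "pairwise orthogonal (v ` ?E)"
    proof (rule pairwiseI)
      fix x y assume "x \<in> v ` ?E" "y \<in> v ` ?E" "x \<noteq> y"
      then obtain l k where lk: "l \<in> ?E" "k \<in> ?E" "x = v l" "y = v k" by (elim imageE)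
      with \<open>x \<noteq> y\<close> have "l \<noteq> k" by auto
      then show "orthogonal x y" using orth[OF lk(1,2)] lk(3,4) by simp
    qed
    show "0 \<notin> v ` ?E"
    proof
      assume "0 \<in> v ` ?E"
      then obtain l where "l \<in> ?E" "0 = v l" by (rule imageE)
      then show False using v[of l] by simp
    qed
  qed
  ultimately show ?thesis by (rule finite_imageD[rotated])
qed

text \<open>A maximiser of the Rayleigh quotient on the unit sphere, with maximum \<open>l\<close>, lies in the
  kernel of the positive semidefinite matrix \<open>l I - A\<close>.\<close>

lemma self_adjoint_max_eigenvector:
  fixes A :: "real^'n^'n"
  assumes A: "self_adjoint A"
  obtains v l where "norm v = 1" "A *v v = l *\<^sub>R v" "\<And>x. x \<bullet> (A *v x) \<le> l * (x \<bullet> x)"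
proof -
  have "compact (sphere (0::real^'n) 1)" "sphere (0::real^'n) 1 \<noteq> {}"
    by auto
  moreover have "continuous_on (sphere 0 1) (\<lambda>x. x \<bullet> (A *v x))"
    by (intro continuous_intros)
  ultimately obtain v where v: "norm v = 1"
    and le: "\<And>x. norm x = 1 \<Longrightarrow> x \<bullet> (A *v x) \<le> v \<bullet> (A *v v)"
    using continuous_attains_sup[of "sphere (0::real^'n) 1" "\<lambda>x. x \<bullet> (A *v x)"]
    by (metis mem_sphere_0)
  define l where "l = v \<bullet> (A *v v)"
  have l: "x \<bullet> (A *v x) \<le> l * (x \<bullet> x)" for x
  proof (cases "x = 0")
    case False
    define u where "u = x /\<^sub>R norm x"
    have "norm u = 1" and x: "x = norm x *\<^sub>R u" using False by (auto simp: u_def)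
    then have "u \<bullet> (A *v u) \<le> l" using le by (simp add: l_def)
    moreover have "x \<bullet> (A *v x) = (norm x)\<^sup>2 * (u \<bullet> (A *v u))"
      by (subst (1 2) x) (simp add: matrix_vector_mult_scaleR power2_eq_square)
    ultimately show ?thesis
      by (simp add: power2_norm_eq_inner[symmetric] mult.commute[of _ "(norm x)\<^sup>2"] mult_left_mono)
  qed simp
  define B where "B = l *\<^sub>R mat 1 - A"
  have B: "B *v x = l *\<^sub>R x - A *v x" for x
    by (simp add: B_def matrix_vector_mult_diff_rdistrib scaleR_matrix_vector_assoc[symmetric])
  have "B *v v = 0"
  proof (rule pos_semidef_kernel)
    show "self_adjoint B"
      using A by (simp add: self_adjoint_def B inner_diff_left inner_diff_right)
    show "pos_semidef B"
      using l by (simp add: pos_semidef_def B inner_diff_right)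
    show "v \<bullet> (B *v v) = 0"
      using v by (simp add: B inner_diff_right l_def power2_norm_eq_inner[symmetric])
  qed
  then show thesis
    using that[of v l] v(1) l by (simp add: B)
qed

text \<open>Identifies \<open>lambda_max\<close> with the maximal Rayleigh quotient: that maximum is
  itself an eigenvalue, and every other eigenvalue is the Rayleigh quotient of its own
  eigenvector.\<close>

lemma lambda_max_eigenvector:
  fixes A :: "real^'n^'n"
  assumes A: "self_adjoint A"
  obtains v where "norm v = 1" "A *v v = lambda_max A *\<^sub>R v"
    "\<And>x. x \<bullet> (A *v x) \<le> lambda_max A * (x \<bullet> x)"
proof -
  obtain v l where v: "norm v = 1" "A *v v = l *\<^sub>R v" "\<And>x. x \<bullet> (A *v x) \<le> l * (x \<bullet> x)"
    by (rule self_adjoint_max_eigenvector[OF A]) blast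
  have "lambda_max A = l"
    unfolding lambda_max_def
  proof (rule Max_eqI[OF self_adjoint_finite_eigenvalues[OF A]])
    show "l \<in> {l. \<exists>v. v \<noteq> 0 \<and> A *v v = l *\<^sub>R v}"
    proof -
      have "v \<noteq> 0" using v(1) by force
      then show ?thesis using v(2) by blast
    qed
  next
    fix k assume "k \<in> {l. \<exists>v. v \<noteq> 0 \<and> A *v v = l *\<^sub>R v}"
    then obtain u where u: "u \<noteq> 0" "A *v u = k *\<^sub>R u" by blast
    then have "k * (u \<bullet> u) \<le> l * (u \<bullet> u)" using v(3)[of u] by simp
    then show "k \<le> l" using u by simp
  qed
  then show thesis using that v by blast
qed

text \<open>A top unit eigenvector of \<open>A\<close> is a test vector for the Rayleigh quotient of
  \<open>A + B\<close>, to which \<open>B\<close> contributes a nonnegative amount.\<close>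

lemma lambda_max_le_add:
  fixes A B :: "real^'n^'n"
  assumes "self_adjoint A" "self_adjoint (A + B)" "pos_semidef B"
  shows "lambda_max A \<le> lambda_max (A + B)"
proof -
  obtain v where v: "norm v = 1" "A *v v = lambda_max A *\<^sub>R v"
    by (rule lambda_max_eigenvector[OF assms(1)])
  then have "lambda_max A = v \<bullet> (A *v v)" by (simp add: power2_norm_eq_inner[symmetric])
  also have "\<dots> \<le> v \<bullet> ((A + B) *v v)"
    using assms(3) by (simp add: pos_semidef_def matrix_vector_mult_add_rdistrib inner_add_right)
  also have "\<dots> \<le> lambda_max (A + B) * (v \<bullet> v)"
    by (rule lambda_max_eigenvector[OF assms(2)])
  finally show ?thesis using v by (simp add: power2_norm_eq_inner[symmetric])
qed

lemma lambda_max_nonneg: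
  assumes "self_adjoint A" "pos_semidef A"
  shows "0 \<le> lambda_max A"
proof -
  obtain v where v: "norm v = 1" "A *v v = lambda_max A *\<^sub>R v"
    by (rule lambda_max_eigenvector[OF assms(1)])
  then show ?thesis
    using assms(2)[unfolded pos_semidef_def, rule_format, of v]
    by (simp add: power2_norm_eq_inner[symmetric])
qed

lemma lambda_max_le_norm:
  fixes A :: "real^'n^'n"
  assumes "self_adjoint A"
  shows "lambda_max A \<le> real CARD('n) * real CARD('n) * norm A"
proof -
  obtain v where v: "norm v = 1" "A *v v = lambda_max A *\<^sub>R v"
    by (rule lambda_max_eigenvector[OF assms])
  then show ?thesis using norm_matrix_vector_mult_le[of A v] by simp
qed

section \<open>Projections onto nested subspaces and diameters of projected sets\<close>

section \<open>Orthogonal projections\<close>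

text \<open>Justifies the definite description in \<open>orth_proj\<close>: existence is the
  orthogonal decomposition, and the difference of two candidates lies in \<open>W\<close> and is
  orthogonal to itself.\<close>

lemma orth_proj_props:
  assumes "subspace W"
  shows "orth_proj W x \<in> W" "w \<in> W \<Longrightarrow> orthogonal (x - orth_proj W x) w"
proof -
  obtain y z where yz: "y \<in> W" "\<And>w. w \<in> W \<Longrightarrow> orthogonal z w" "x = y + z"
    using orthogonal_subspace_decomp_exists[of W x] unfolding span_eq_iff[THEN iffD2, OF assms] by blast
  have "p = y" if p: "p \<in> W" "\<forall>w\<in>W. orthogonal (x - p) w" for p
  proof -
    have "y - p \<in> W" using p yz assms by (simp add: subspace_diff)
    then have "orthogonal (x - p) (y - p)" "orthogonal z (y - p)" using p yz by auto
    then have "(y - p) \<bullet> (y - p) = 0"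
      by (simp add: orthogonal_def yz(3) algebra_simps)
    then show ?thesis by simp
  qed
  then have "\<exists>!p. p \<in> W \<and> (\<forall>w\<in>W. orthogonal (x - p) w)"
    using yz(1,2) by (intro ex1I[of _ y]) (auto simp: yz(3))
  from theI'[OF this] show "orth_proj W x \<in> W" "w \<in> W \<Longrightarrow> orthogonal (x - orth_proj W x) w"
    by (auto simp: orth_proj_def)
qed

text \<open>Both \<open>d\<close> and \<open>r\<close> differ from \<open>x - y\<close> by vectors
  orthogonal to \<open>d\<close>, so \<open>d \<bullet> d = r \<bullet> d\<close>, and
  Cauchy-Schwarz finishes.\<close>

lemma dist_orth_proj_mono:
  assumes V: "subspace V" and W: "subspace W" and "V \<subseteq> W"
  shows "dist (orth_proj V x) (orth_proj V y) \<le> dist (orth_proj W x) (orth_proj W y)"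
proof -
  define d where "d = orth_proj V x - orth_proj V y"
  define r where "r = orth_proj W x - orth_proj W y"
  have d: "d \<in> V" unfolding d_def by (intro subspace_diff V orth_proj_props)
  then have "d \<in> W" using assms by blast
  have "d \<bullet> d = r \<bullet> d"
    using orth_proj_props(2)[OF V d, of x] orth_proj_props(2)[OF V d, of y]
      orth_proj_props(2)[OF W \<open>d \<in> W\<close>, of x] orth_proj_props(2)[OF W \<open>d \<in> W\<close>, of y]
    unfolding orthogonal_def by (simp add: d_def r_def inner_diff_left)
  then have "norm d * norm d \<le> norm r * norm d"
    using norm_cauchy_schwarz[of r d] by (simp add: power2_norm_eq_inner[symmetric] power2_eq_square)
  then have "norm d \<le> norm r"
    by (cases "d = 0") simp_all
  then show ?thesis by (simp add: d_def r_def dist_norm)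
qed

text \<open>Turns the case \<open>W = UNIV\<close> of \<open>dist_orth_proj_mono\<close> into the
  statement that projections are contractions.\<close>

lemma orth_proj_UNIV: "orth_proj UNIV x = x"
  using orth_proj_props(2)[of UNIV "x - orth_proj UNIV x" x] by (simp add: orthogonal_self)

lemma bounded_orth_proj_image:
  assumes "subspace W" "bounded X"
  shows "bounded (orth_proj W ` X)"
proof -
  obtain B where "\<forall>x\<in>X. \<forall>y\<in>X. dist x y \<le> B"
    using assms(2) by (meson bounded_two_points)
  then have "\<forall>x\<in>X. \<forall>y\<in>X. dist (orth_proj W x) (orth_proj W y) \<le> B"
    using dist_orth_proj_mono[OF assms(1) subspace_UNIV] unfolding orth_proj_UNIV
    by (meson order_trans subset_UNIV)
  then show ?thesis by (auto simp: bounded_two_points)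
qed

lemma diameter_orth_proj_mono:
  assumes "subspace V" "subspace W" "V \<subseteq> W" "bounded X"
  shows "diameter (orth_proj V ` X) \<le> diameter (orth_proj W ` X)"
proof (rule diameter_le)
  \<comment> \<open>The second disjunct is the one proved, which also covers empty
    \<open>X\<close>.\<close>
  show "orth_proj V ` X \<noteq> {} \<or> 0 \<le> diameter (orth_proj W ` X)"
    by (simp add: diameter_ge_0 bounded_orth_proj_image assms)
next
  fix p r assume "p \<in> orth_proj V ` X" "r \<in> orth_proj V ` X"
  then obtain x y where xy: "x \<in> X" "y \<in> X" "p = orth_proj V x" "r = orth_proj V y" by blast
  have "dist p r \<le> dist (orth_proj W x) (orth_proj W y)"
    unfolding xy by (rule dist_orth_proj_mono[OF assms(1-3)])
  also have "\<dots> \<le> diameter (orth_proj W ` X)"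
    using xy by (intro diameter_bounded_bound bounded_orth_proj_image assms) auto
  finally show "norm (p - r) \<le> diameter (orth_proj W ` X)" by (simp add: dist_norm)
qed

section \<open>Existence of gradients, restriction to lines, and symmetry of the Hessian\<close>

section \<open>Gradients and Hessians\<close>

lemma gderiv_unique:
  fixes f :: "real^'n \<Rightarrow> real"
  assumes "GDERIV f x :> D" "GDERIV f x :> E"
  shows "D = E"
proof -
  have "(\<lambda>h. h \<bullet> D) = (\<lambda>h. h \<bullet> E)"
    using assms unfolding gderiv_def by (rule has_derivative_unique)
  then show ?thesis by (metis vector_eq_ldot)
qed

text \<open>A linear functional \<open>f'\<close> is represented by the vector
  \<open>adjoint f' 1\<close>; uniqueness then lets \<open>THE\<close> pick out this vector.\<close>

lemma gderiv_grad:
  fixes f :: "real^'n \<Rightarrow> real"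
  assumes "f differentiable (at x)"
  shows "GDERIV f x :> grad f x"
proof -
  obtain f' where f': "(f has_derivative f') (at x)"
    using assms unfolding differentiable_def by blast
  then have "linear f'" by (rule has_derivative_linear)
  then have "f' = (\<lambda>h. h \<bullet> adjoint f' 1)"
    by (simp add: adjoint_works)
  then have "GDERIV f x :> adjoint f' 1" using f' by (simp add: gderiv_def)
  then show ?thesis unfolding grad_def by (rule theI) (rule gderiv_unique[OF _ \<open>GDERIV f x :> adjoint f' 1\<close>])
qed

lemma C2_on_gderiv:
  assumes "C2_on U f" "x \<in> U"
  shows "GDERIV f x :> grad f x"
  using assms by (simp add: C2_on_def gderiv_grad)

lemma C2_on_grad_has_derivative:
  assumes "C2_on U f" "x \<in> U"
  shows "(grad f has_derivative (*v) (hess f x)) (at x)"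
  using assms by (simp add: C2_on_def hess_def flip: jacobian_works)

lemma gderiv_line:
  fixes f :: "real^'n \<Rightarrow> real"
  assumes "GDERIV f (a + t *\<^sub>R v) :> D"
  shows "((\<lambda>t. f (a + t *\<^sub>R v)) has_real_derivative v \<bullet> D) (at t)"
proof -
  have "((\<lambda>t. a + t *\<^sub>R v) has_derivative (\<lambda>h. h *\<^sub>R v)) (at t)"
    by (auto intro!: derivative_eq_intros)
  from has_derivative_compose[OF this assms[unfolded gderiv_def]]
  show ?thesis by (simp add: has_field_derivative_def mult.commute[of _ "v \<bullet> D"] fun_eq_iff)
qed

lemma grad_line:
  assumes "C2_on U f" "a + t *\<^sub>R v \<in> U"
  shows "((\<lambda>t. u \<bullet> grad f (a + t *\<^sub>R v)) has_real_derivative u \<bullet> (hess f (a + t *\<^sub>R v) *v v)) (at t)"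
proof -
  have "((\<lambda>t. a + t *\<^sub>R v) has_derivative (\<lambda>h. h *\<^sub>R v)) (at t)"
    by (auto intro!: derivative_eq_intros)
  from has_derivative_inner_right[OF has_derivative_compose[OF this C2_on_grad_has_derivative[OF assms]], of u]
  show ?thesis
    by (simp add: has_field_derivative_def matrix_vector_mult_scaleR mult.commute[of _ "u \<bullet> _"])
qed

text \<open>The mean value theorem is applied twice, once in each direction. The bound on
  \<open>norm u + norm v\<close> keeps the whole parallelogram at \<open>x\<close> inside the
  ball.\<close>

lemma mixed_difference_mvt:
  fixes f :: "real^'n \<Rightarrow> real"
  assumes f: "C2_on U f" and U: "ball x r \<subseteq> U" and uv: "norm u + norm v < r"
  obtains y where "y \<in> ball x r"
    "f (x + u + v) - f (x + u) - (f (x + v) - f x) = u \<bullet> (hess f y *v v)"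
proof -
  have in_ball: "x + s *\<^sub>R u + t *\<^sub>R v \<in> ball x r" if "0 \<le> s" "s \<le> 1" "0 \<le> t" "t \<le> 1" for s t
  proof -
    have "norm (s *\<^sub>R u + t *\<^sub>R v) \<le> s * norm u + t * norm v"
      using norm_triangle_ineq[of "s *\<^sub>R u" "t *\<^sub>R v"] that by simp
    also have "\<dots> \<le> 1 * norm u + 1 * norm v"
      using that by (intro add_mono mult_right_mono) auto
    finally have "norm (s *\<^sub>R u + t *\<^sub>R v) < r" using uv by simp
    moreover have "x - (x + s *\<^sub>R u + t *\<^sub>R v) = - (s *\<^sub>R u + t *\<^sub>R v)" by simp
    ultimately show ?thesis by (simp only: mem_ball dist_norm norm_minus_cancel)
  qed
  then have in_U: "x + s *\<^sub>R u + t *\<^sub>R v \<in> U" if "0 \<le> s" "s \<le> 1" "0 \<le> t" "t \<le> 1" for s t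
    using that U by blast
  \<comment> \<open>The mixed difference is \<open>\<phi> 1 - \<phi> 0\<close>; the derivative of
    \<open>\<phi>\<close> at the intermediate \<open>s\<close> is in turn the increment
    \<open>\<psi> 1 - \<psi> 0\<close> below.\<close>
  define \<phi> where "\<phi> s = f (x + v + s *\<^sub>R u) - f (x + s *\<^sub>R u)" for s
  have "(\<phi> has_real_derivative u \<bullet> grad f (x + v + s *\<^sub>R u) - u \<bullet> grad f (x + s *\<^sub>R u)) (at s)"
    if "0 \<le> s" "s \<le> 1" for s
    unfolding \<phi>_def
  proof (intro DERIV_diff gderiv_line C2_on_gderiv[OF f])
    show "x + v + s *\<^sub>R u \<in> U" using in_U[of s 1] that by (simp add: ac_simps)
    show "x + s *\<^sub>R u \<in> U" using in_U[of s 0] that by simp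
  qed
  from MVT2[of 0 1 \<phi>, OF _ this] obtain s where s: "0 < s" "s < 1"
    and \<phi>: "\<phi> 1 - \<phi> 0 = u \<bullet> grad f (x + v + s *\<^sub>R u) - u \<bullet> grad f (x + s *\<^sub>R u)" by auto
  define \<psi> where "\<psi> t = u \<bullet> grad f (x + s *\<^sub>R u + t *\<^sub>R v)" for t
  have "(\<psi> has_real_derivative u \<bullet> (hess f (x + s *\<^sub>R u + t *\<^sub>R v) *v v)) (at t)"
    if "0 \<le> t" "t \<le> 1" for t
    unfolding \<psi>_def using in_U s that by (intro grad_line[OF f]) simp
  from MVT2[of 0 1 \<psi>, OF _ this] obtain t where t: "0 < t" "t < 1"
    and \<psi>: "\<psi> 1 - \<psi> 0 = u \<bullet> (hess f (x + s *\<^sub>R u + t *\<^sub>R v) *v v)" by auto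
  show thesis
  proof
    show "x + s *\<^sub>R u + t *\<^sub>R v \<in> ball x r" using in_ball s t by simp
    have "\<phi> 1 - \<phi> 0 = \<psi> 1 - \<psi> 0" using \<phi> by (simp add: \<psi>_def ac_simps)
    then show "f (x + u + v) - f (x + u) - (f (x + v) - f x) =
        u \<bullet> (hess f (x + s *\<^sub>R u + t *\<^sub>R v) *v v)"
      using \<psi> by (simp add: \<phi>_def ac_simps)
  qed
qed

text \<open>Symmetry of second derivatives: the mixed difference is unchanged when \<open>u\<close>
  and \<open>v\<close> are swapped, so \<open>mixed_difference_mvt\<close> in both orders equates
  the two mixed derivatives at points arbitrarily near \<open>x\<close>, and continuity carries this
  to \<open>x\<close>.\<close>

theorem self_adjoint_hess:
  fixes f :: "real^'n \<Rightarrow> real"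
  assumes f: "C2_on U f" and x: "x \<in> U"
  shows "self_adjoint (hess f x)"
  unfolding self_adjoint_def
proof (intro allI, rule ccontr)
  fix u v
  define p where "p y = u \<bullet> (hess f y *v v)" for y
  define q where "q y = v \<bullet> (hess f y *v u)" for y
  assume "u \<bullet> (hess f x *v v) \<noteq> (hess f x *v u) \<bullet> v"
  then have neq: "p x \<noteq> q x" by (simp add: p_def q_def inner_commute)
  \<comment> \<open>With half the gap as radius, the open intervals about \<open>p x\<close> and
    \<open>q x\<close> are disjoint, which rules out \<open>p y = q z\<close>.\<close>
  define e where "e = \<bar>p x - q x\<bar> / 2"
  have "e > 0" using neq by (simp add: e_def)
  have U: "open U" and H: "continuous_on U (hess f)" using f by (auto simp: C2_on_def)
  have "continuous_on U p" "continuous_on U q"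
    unfolding p_def q_def using H by (intro continuous_intros; assumption)+
  then have "isCont p x" "isCont q x"
    using U x continuous_on_eq_continuous_at by blast+
  obtain r1 where r1: "r1 > 0" "ball x r1 \<subseteq> U" using U x openE by blast
  obtain r2 where r2: "r2 > 0" "\<And>y. dist y x < r2 \<Longrightarrow> dist (p y) (p x) < e"
    using \<open>isCont p x\<close> \<open>e > 0\<close> unfolding continuous_at_eps_delta by blast
  obtain r3 where r3: "r3 > 0" "\<And>y. dist y x < r3 \<Longrightarrow> dist (q y) (q x) < e"
    using \<open>isCont q x\<close> \<open>e > 0\<close> unfolding continuous_at_eps_delta by blast
  define r where "r = min r1 (min r2 r3)"
  \<comment> \<open>The summand 1 makes the inequality strict:
    \<open>t * (norm u + norm v) = r - t < r\<close>.\<close>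
  define t where "t = r / (norm u + norm v + 1)"
  have r: "r > 0" "ball x r \<subseteq> U" using r1 r2 r3 by (auto simp: r_def)
  have pos: "norm u + norm v + 1 > 0"
    using norm_ge_zero[of u] norm_ge_zero[of v] by linarith
  have t: "t > 0" using r pos by (simp add: t_def)
  have "t * (norm u + norm v + 1) = r" using pos by (simp add: t_def)
  then have "norm (t *\<^sub>R u) + norm (t *\<^sub>R v) < r" using t by (simp add: algebra_simps)
  then have small: "norm (t *\<^sub>R u) + norm (t *\<^sub>R v) < r" "norm (t *\<^sub>R v) + norm (t *\<^sub>R u) < r" by auto
  obtain y where y: "y \<in> ball x r" "f (x + t *\<^sub>R u + t *\<^sub>R v) - f (x + t *\<^sub>R u) - (f (x + t *\<^sub>R v) - f x)
      = t *\<^sub>R u \<bullet> (hess f y *v (t *\<^sub>R v))"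
    by (rule mixed_difference_mvt[OF f r(2) small(1)])
  obtain z where z: "z \<in> ball x r" "f (x + t *\<^sub>R v + t *\<^sub>R u) - f (x + t *\<^sub>R v) - (f (x + t *\<^sub>R u) - f x)
      = t *\<^sub>R v \<bullet> (hess f z *v (t *\<^sub>R u))"
    by (rule mixed_difference_mvt[OF f r(2) small(2)])
  have "t *\<^sub>R u \<bullet> (hess f y *v (t *\<^sub>R v)) = t *\<^sub>R v \<bullet> (hess f z *v (t *\<^sub>R u))"
    unfolding y(2)[symmetric] z(2)[symmetric] by (simp add: ac_simps)
  then have "p y = q z" using t by (simp add: p_def q_def matrix_vector_mult_scaleR)
  moreover have "dist (p y) (p x) < e" "dist (q z) (q x) < e"
    using y(1) z(1) by (auto intro!: r2(2) r3(2) simp: r_def dist_commute[of x])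
  ultimately show False by (simp add: dist_real_def e_def abs_if split: if_splits)
qed

section \<open>Full dimensional convex sets: vanishing derivatives, tangent inequality, semidefinite
  Hessians\<close>

section \<open>Derivatives on convex sets\<close>

text \<open>Along each segment from \<open>x\<close> into \<open>S\<close> the map is constantly
  zero, so \<open>F' (y - x) = 0\<close> for \<open>y\<close> in \<open>S\<close>. The solutions
  \<open>y\<close> of this equation form an affine set, which therefore contains the affine hull of
  \<open>S\<close>, the whole space.\<close>

lemma has_derivative_zero_on_convex:
  fixes F :: "'a::real_normed_vector \<Rightarrow> 'b::real_normed_vector"
  assumes F: "(F has_derivative F') (at x)" and S: "convex S" "affine hull S = UNIV" "x \<in> S"
    and zero: "\<And>y. y \<in> S \<Longrightarrow> F y = 0"
  shows "F' v = 0"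
proof -
  have lin: "linear F'" using F by (rule has_derivative_linear)
  have S0: "F' (y - x) = 0" if "y \<in> S" for y
  proof -
    define \<phi> where "\<phi> t = F (x + t *\<^sub>R (y - x))" for t :: real
    have "((\<lambda>t. x + t *\<^sub>R (y - x)) has_derivative (\<lambda>h. h *\<^sub>R (y - x))) (at 0)"
      by (auto intro!: derivative_eq_intros)
    then have "(\<phi> has_derivative (\<lambda>h. F' (h *\<^sub>R (y - x)))) (at 0)"
      unfolding \<phi>_def by (rule has_derivative_compose) (simp add: F)
    then have "(\<phi> has_vector_derivative F' (y - x)) (at 0)"
      by (simp add: has_vector_derivative_def linear_cmul[OF lin])
    \<comment> \<open>For \<open>t < 0\<close> the line may leave \<open>S\<close>, so only the
      one-sided derivative at 0 can be compared with zero.\<close>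
    then have 1: "(\<phi> has_vector_derivative F' (y - x)) (at 0 within {0..1})"
      by (rule has_vector_derivative_at_within)
    have "\<phi> t = 0" if "t \<in> {0..1}" for t
    proof -
      have "x + t *\<^sub>R (y - x) = (1 - t) *\<^sub>R x + t *\<^sub>R y" by (simp add: algebra_simps)
      then have "x + t *\<^sub>R (y - x) \<in> S"
        using S \<open>y \<in> S\<close> that by (simp add: convex_alt)
      then show ?thesis by (simp add: \<phi>_def zero)
    qed
    then have 2: "(\<phi> has_vector_derivative 0) (at 0 within {0..1})"
      by (intro has_vector_derivative_transform[OF _ _ has_vector_derivative_const[of 0]]) auto
    show ?thesis
      by (rule vector_derivative_unique_within[OF _ 1 2]) (simp add: at_within_Icc_at_right trivial_limit_at_right_real)
  qed
  have "affine {y. F' (y - x) = 0}"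
    unfolding affine_def
  proof (intro ballI allI impI)
    fix y z and a b :: real
    assume yz: "y \<in> {y. F' (y - x) = 0}" "z \<in> {y. F' (y - x) = 0}" and "a + b = 1"
    then have "x = a *\<^sub>R x + b *\<^sub>R x" by (simp add: scaleR_add_left[symmetric])
    then have "a *\<^sub>R y + b *\<^sub>R z - x = a *\<^sub>R (y - x) + b *\<^sub>R (z - x)"
      by (metis add_diff_add scaleR_right_diff_distrib)
    then show "a *\<^sub>R y + b *\<^sub>R z \<in> {y. F' (y - x) = 0}"
      using yz by (simp add: linear_add[OF lin] linear_cmul[OF lin])
  qed
  then have "affine hull S \<subseteq> {y. F' (y - x) = 0}"
    using S0 by (intro hull_minimal) auto
  then have "x + v \<in> {y. F' (y - x) = 0}" using S(2) by blast
  then show ?thesis by simp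
qed

text \<open>By convexity the difference quotients along the segment are at most
  \<open>g y - g x\<close>. Passing to the limit from the right makes this valid at boundary points
  of \<open>S\<close> as well.\<close>

lemma convex_on_tangent_le:
  fixes g :: "real^'n \<Rightarrow> real"
  assumes g: "convex_on S g" and x: "x \<in> S" and y: "y \<in> S" and D: "GDERIV g x :> D"
  shows "g x + D \<bullet> (y - x) \<le> g y"
proof -
  have "((\<lambda>t. g (x + t *\<^sub>R (y - x))) has_real_derivative (y - x) \<bullet> D) (at 0)"
    by (rule gderiv_line) (simp add: D)
  then have "((\<lambda>t. (g (x + t *\<^sub>R (y - x)) - g x) / t) \<longlongrightarrow> (y - x) \<bullet> D) (at 0)"
    by (simp add: DERIV_def)
  then have "((\<lambda>t. (g (x + t *\<^sub>R (y - x)) - g x) / t) \<longlongrightarrow> (y - x) \<bullet> D) (at_right 0)"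
    by (simp add: filterlim_at_split)
  moreover have "\<forall>\<^sub>F t in at_right 0. (g (x + t *\<^sub>R (y - x)) - g x) / t \<le> g y - g x"
  proof (rule eventually_at_rightI[of 0 1])
    fix t :: real assume t: "t \<in> {0<..<1}"
    have "x + t *\<^sub>R (y - x) = (1 - t) *\<^sub>R x + t *\<^sub>R y" by (simp add: algebra_simps)
    moreover have "g ((1 - t) *\<^sub>R x + t *\<^sub>R y) \<le> (1 - t) * g x + t * g y"
      using t by (intro convex_onD[OF g] x y) auto
    ultimately have "g (x + t *\<^sub>R (y - x)) - g x \<le> (g y - g x) * t" by (simp add: algebra_simps)
    then show "(g (x + t *\<^sub>R (y - x)) - g x) / t \<le> g y - g x" using t by (simp add: pos_divide_le_eq)
  qed simp
  ultimately have "(y - x) \<bullet> D \<le> g y - g x"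
    by (rule tendsto_upperbound) simp
  then show ?thesis by (simp add: inner_commute)
qed

text \<open>Adding the tangent inequalities at \<open>x\<close> and at
  \<open>x + t *\<^sub>R v\<close> shows that the gradient is monotone along \<open>v\<close>;
  dividing by \<open>t\<close> and letting it tend to 0 gives the Hessian form. Interiority keeps
  \<open>x + t *\<^sub>R v\<close> in \<open>S\<close> for small \<open>t\<close>.\<close>

lemma pos_semidef_hess_interior:
  fixes g :: "real^'n \<Rightarrow> real"
  assumes g: "convex_on S g" and U: "C2_on U g" "S \<subseteq> U" and x: "x \<in> interior S"
  shows "pos_semidef (hess g x)"
  unfolding pos_semidef_def
proof
  fix v
  have "x \<in> S" using x interior_subset by blast
  then have "x + 0 *\<^sub>R v \<in> U" using U by auto
  from grad_line[OF U(1) this, of v]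
  have "((\<lambda>t. (v \<bullet> grad g (x + t *\<^sub>R v) - v \<bullet> grad g x) / t) \<longlongrightarrow> v \<bullet> (hess g x *v v)) (at 0)"
    by (simp add: DERIV_def)
  then have "((\<lambda>t. (v \<bullet> grad g (x + t *\<^sub>R v) - v \<bullet> grad g x) / t) \<longlongrightarrow> v \<bullet> (hess g x *v v)) (at_right 0)"
    by (simp add: filterlim_at_split)
  moreover have "\<forall>\<^sub>F t in at_right 0. 0 \<le> (v \<bullet> grad g (x + t *\<^sub>R v) - v \<bullet> grad g x) / t"
  proof -
    have "((\<lambda>t::real. x + t *\<^sub>R v) \<longlongrightarrow> x) (at_right 0)"
      by (auto intro!: tendsto_eq_intros)
    then have "\<forall>\<^sub>F t in at_right (0::real). x + t *\<^sub>R v \<in> interior S"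
      using x by (intro topological_tendstoD) auto
    moreover have "\<forall>\<^sub>F t in at_right (0::real). t > 0"
      by (simp add: eventually_at_right_less)
    ultimately show ?thesis
    proof eventually_elim
      case (elim t)
      define y where "y = x + t *\<^sub>R v"
      have "y \<in> S" using elim interior_subset by (auto simp: y_def)
      have "g x + grad g x \<bullet> (y - x) \<le> g y"
        using U \<open>x \<in> S\<close> by (intro convex_on_tangent_le[OF g \<open>x \<in> S\<close> \<open>y \<in> S\<close>] C2_on_gderiv[of U]) auto
      moreover have "g y + grad g y \<bullet> (x - y) \<le> g x"
        using U \<open>y \<in> S\<close> by (intro convex_on_tangent_le[OF g \<open>y \<in> S\<close> \<open>x \<in> S\<close>] C2_on_gderiv[of U]) auto
      ultimately have "0 \<le> t * (v \<bullet> grad g y - v \<bullet> grad g x)"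
        by (simp add: y_def inner_commute algebra_simps)
      then show ?case using elim by (simp add: y_def zero_le_mult_iff)
    qed
  qed
  ultimately show "0 \<le> v \<bullet> (hess g x *v v)"
    by (rule tendsto_lowerbound) simp
qed

text \<open>A closed convex set with nonempty interior is the closure of that interior, and the
  continuous Hessian form stays nonnegative on the closure.\<close>

lemma pos_semidef_hess:
  fixes g :: "real^'n \<Rightarrow> real"
  assumes g: "convex_on S g" and U: "C2_on U g" "S \<subseteq> U" and S: "compact S" "interior S \<noteq> {}"
    and x: "x \<in> S"
  shows "pos_semidef (hess g x)"
  unfolding pos_semidef_def
proof
  fix v
  \<comment> \<open>The predicate \<open>convex_on\<close> includes convexity of its domain.\<close>
  have "convex S" using g by (simp add: convex_on_def)
  then have cl: "closure (interior S) = S"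
    using S by (simp add: convex_closure_interior compact_imp_closed closure_closed)
  have "continuous_on S (hess g)" using U by (auto simp: C2_on_def intro: continuous_on_subset)
  then have "continuous_on (closure (interior S)) (\<lambda>z. v \<bullet> (hess g z *v v))"
    unfolding cl by (intro continuous_intros)
  then show "0 \<le> v \<bullet> (hess g x *v v)"
    by (rule continuous_ge_on_closure)
      (use x cl pos_semidef_hess_interior[OF g U] in \<open>auto simp: pos_semidef_def\<close>)
qed

text \<open>With full affine hull, the relative interior, nonempty for a nonempty convex set, is the
  interior.\<close>

lemma interior_convex_nonempty:
  fixes S :: "'a::euclidean_space set"
  assumes "convex S" "affine hull S = UNIV"
  shows "interior S \<noteq> {}"
proof -
  have "S \<noteq> {}" using assms by auto
  then show ?thesis using assms by (metis rel_interior_eq_empty rel_interior_interior)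
qed

section \<open>Additivity of derivatives on the hull and monotonicity of the complexity
  quantities\<close>

section \<open>Weak domination\<close>

text \<open>The identity for \<open>q\<close> is known only on \<open>S\<close>, whereas a gradient
  at a boundary point depends on values outside \<open>S\<close>. The vanishing-derivative lemma
  bridges this; evaluating the derivative in its own direction \<open>?D\<close> gives
  \<open>?D \<bullet> ?D = 0\<close>.\<close>

lemma grad_diff_on_convex:
  fixes g\<^sub>1 g\<^sub>2 q :: "real^'n \<Rightarrow> real"
  assumes C2: "C2_on U g\<^sub>1" "C2_on V g\<^sub>2" "C2_on W q"
    and sub: "S \<subseteq> U" "S \<subseteq> V" "S \<subseteq> W" and S: "convex S" "affine hull S = UNIV"
    and q: "\<And>x. x \<in> S \<Longrightarrow> q x = g\<^sub>2 x - g\<^sub>1 x" and x: "x \<in> S"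
  shows "grad q x = grad g\<^sub>2 x - grad g\<^sub>1 x"
proof -
  let ?D = "grad g\<^sub>2 x - grad g\<^sub>1 x - grad q x"
  have "GDERIV (\<lambda>x. g\<^sub>2 x - g\<^sub>1 x - q x) x :> ?D"
    using C2 sub x by (intro GDERIV_diff) (auto intro: C2_on_gderiv)
  then have "((\<lambda>x. g\<^sub>2 x - g\<^sub>1 x - q x) has_derivative (\<lambda>h. h \<bullet> ?D)) (at x)"
    by (simp add: gderiv_def)
  then have "?D \<bullet> ?D = 0"
    by (rule has_derivative_zero_on_convex) (use S x q in auto)
  then have "?D = 0" by (simp only: inner_eq_zero_iff)
  then show ?thesis by (simp add: algebra_simps)
qed

text \<open>The same argument one order higher, for the difference of gradients, which vanishes on
  \<open>S\<close> by \<open>grad_diff_on_convex\<close>.\<close>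

lemma hess_diff_on_convex:
  fixes g\<^sub>1 g\<^sub>2 q :: "real^'n \<Rightarrow> real"
  assumes C2: "C2_on U g\<^sub>1" "C2_on V g\<^sub>2" "C2_on W q"
    and sub: "S \<subseteq> U" "S \<subseteq> V" "S \<subseteq> W" and S: "convex S" "affine hull S = UNIV"
    and q: "\<And>x. x \<in> S \<Longrightarrow> q x = g\<^sub>2 x - g\<^sub>1 x" and x: "x \<in> S"
  shows "hess q x = hess g\<^sub>2 x - hess g\<^sub>1 x"
proof -
  let ?F = "\<lambda>x. grad g\<^sub>2 x - grad g\<^sub>1 x - grad q x"
  have "(?F has_derivative (\<lambda>h. hess g\<^sub>2 x *v h - hess g\<^sub>1 x *v h - hess q x *v h)) (at x)"
    using C2 sub x by (intro has_derivative_diff) (auto intro: C2_on_grad_has_derivative)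
  then have "hess g\<^sub>2 x *v h - hess g\<^sub>1 x *v h - hess q x *v h = 0" for h
    by (rule has_derivative_zero_on_convex)
      (use S x grad_diff_on_convex[OF C2 sub S q] in auto)
  then show ?thesis
    by (simp add: matrix_eq matrix_vector_mult_diff_rdistrib algebra_simps)
qed

lemma subspace_V_X: "subspace (V_X X g)"
  by (simp add: V_X_def subspace_span)

lemma hess_mult_in_V_X:
  assumes "z \<in> convex hull X"
  shows "hess g z *v v \<in> V_X X g"
  unfolding V_X_def using assms by (intro span_base) blast

text \<open>\<open>V_X_add\<close> uses this twice, with the two summands exchanging roles.\<close>

lemma V_X_subset_add:
  fixes g\<^sub>1 g\<^sub>2 :: "real^'n \<Rightarrow> real"
  assumes add: "\<And>z. z \<in> convex hull X \<Longrightarrow> hess g\<^sub>2 z = hess g\<^sub>1 z + H z"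
    and sa: "\<And>z. z \<in> convex hull X \<Longrightarrow> self_adjoint (hess g\<^sub>1 z)"
    and psd: "\<And>z. z \<in> convex hull X \<Longrightarrow> pos_semidef (hess g\<^sub>1 z)"
      "\<And>z. z \<in> convex hull X \<Longrightarrow> pos_semidef (H z)"
  shows "V_X X g\<^sub>1 \<subseteq> V_X X g\<^sub>2"
proof -
  have "hess g\<^sub>1 z *v v \<in> V_X X g\<^sub>2" if z: "z \<in> convex hull X" for z v
  proof -
    define p where "p = orth_proj (V_X X g\<^sub>2) (hess g\<^sub>1 z *v v)"
    define w where "w = hess g\<^sub>1 z *v v - p"
    have p: "p \<in> V_X X g\<^sub>2"
      unfolding p_def by (intro orth_proj_props subspace_V_X)
    have w: "w \<bullet> u = 0" if "u \<in> V_X X g\<^sub>2" for u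
      using orth_proj_props(2)[OF subspace_V_X that] by (simp add: w_def p_def orthogonal_def)
    \<comment> \<open>The left side is \<open>w \<bullet> (hess g\<^sub>2 z *v w)\<close>, and
      \<open>hess g\<^sub>2 z *v w\<close> lies in the subspace to which \<open>w\<close> is
      orthogonal.\<close>
    have "w \<bullet> (hess g\<^sub>1 z *v w) + w \<bullet> (H z *v w) = 0"
      using w[OF hess_mult_in_V_X[OF z]] add[OF z]
      by (simp add: matrix_vector_mult_add_rdistrib inner_add_right)
    moreover have "0 \<le> w \<bullet> (hess g\<^sub>1 z *v w)" "0 \<le> w \<bullet> (H z *v w)"
      using psd[OF z] by (auto simp: pos_semidef_def)
    ultimately have "w \<bullet> (hess g\<^sub>1 z *v w) = 0" by linarith
    then have "hess g\<^sub>1 z *v w = 0" by (rule pos_semidef_kernel[OF sa[OF z] psd(1)[OF z]])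
    \<comment> \<open>Symmetry moves the matrix from \<open>v\<close> onto \<open>w\<close>, where
      it gives zero.\<close>
    then have "w \<bullet> (hess g\<^sub>1 z *v v) = 0" using sa[OF z] by (simp add: self_adjoint_def)
    then have "w \<bullet> w = 0" using w[OF p] by (simp add: w_def inner_diff_right)
    then show ?thesis using p by (simp add: w_def)
  qed
  then show ?thesis
    unfolding V_X_def[of X g\<^sub>1] by (intro span_minimal subspace_V_X) blast
qed

lemma V_X_add:
  fixes g\<^sub>1 g\<^sub>2 q :: "real^'n \<Rightarrow> real"
  assumes add: "\<And>z. z \<in> convex hull X \<Longrightarrow> hess g\<^sub>2 z = hess g\<^sub>1 z + hess q z"
    and sa: "\<And>z. z \<in> convex hull X \<Longrightarrow> self_adjoint (hess g\<^sub>1 z)"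
      "\<And>z. z \<in> convex hull X \<Longrightarrow> self_adjoint (hess q z)"
    and psd: "\<And>z. z \<in> convex hull X \<Longrightarrow> pos_semidef (hess g\<^sub>1 z)"
      "\<And>z. z \<in> convex hull X \<Longrightarrow> pos_semidef (hess q z)"
  shows "V_X X g\<^sub>2 = V_X X g\<^sub>1 + V_X X q"
proof
  \<comment> \<open>\<open>+\<close> is the Minkowski sum of sets; this is the set-builder form in
    which \<open>subspace_sums\<close> is stated.\<close>
  have sum: "V_X X g\<^sub>1 + V_X X q = {x + y |x y. x \<in> V_X X g\<^sub>1 \<and> y \<in> V_X X q}"
    by (auto simp: set_plus_def)
  have "hess g\<^sub>2 z *v v \<in> V_X X g\<^sub>1 + V_X X q" if "z \<in> convex hull X" for z v
    unfolding add[OF that] matrix_vector_mult_add_rdistrib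
    using that by (intro set_plus_intro hess_mult_in_V_X)
  moreover have "subspace (V_X X g\<^sub>1 + V_X X q)"
    unfolding sum by (intro subspace_sums subspace_V_X)
  ultimately show "V_X X g\<^sub>2 \<subseteq> V_X X g\<^sub>1 + V_X X q"
    unfolding V_X_def[of X g\<^sub>2] by (intro span_minimal) blast+
  have "V_X X g\<^sub>1 \<subseteq> V_X X g\<^sub>2"
    by (rule V_X_subset_add[of X g\<^sub>2 g\<^sub>1 "hess q"]) (use assms in auto)
  moreover have "V_X X q \<subseteq> V_X X g\<^sub>2"
    by (rule V_X_subset_add[of X g\<^sub>2 q "hess g\<^sub>1"]) (use assms in \<open>auto simp: add.commute\<close>)
  ultimately show "V_X X g\<^sub>1 + V_X X q \<subseteq> V_X X g\<^sub>2"
    unfolding sum using subspace_add[OF subspace_V_X[of X g\<^sub>2]] by blast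
qed

text \<open>The supremum in \<open>L_X\<close> behaves as expected only for a set bounded above. The
  Hessian is bounded in norm on the compact set, and a crude multiple of the norm dominates
  \<open>lambda_max\<close>.\<close>

lemma bdd_above_lambda_max_hess:
  fixes g :: "real^'n \<Rightarrow> real"
  assumes S: "compact S" and cont: "continuous_on S (hess g)"
    and sa: "\<And>z. z \<in> S \<Longrightarrow> self_adjoint (hess g z)"
  shows "bdd_above ((\<lambda>z. lambda_max (hess g z)) ` S)"
proof -
  have "bounded (hess g ` S)"
    using S cont by (intro compact_imp_bounded compact_continuous_image)
  then obtain B where B: "\<And>z. z \<in> S \<Longrightarrow> norm (hess g z) \<le> B"
    by (auto simp: bounded_iff)
  have "lambda_max (hess g z) \<le> real CARD('n) * real CARD('n) * B" if "z \<in> S" for z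
    by (rule order_trans[OF lambda_max_le_norm[OF sa[OF that]]])
      (intro mult_left_mono B that, simp)
  then show ?thesis by (rule bdd_aboveI2)
qed

text \<open>The base grows with \<open>D_X\<close> and \<open>L_X\<close>, and since it is at least
  1 the power also grows with the exponent.\<close>

lemma C_eps_mono:
  assumes "0 < e" "d_X X g\<^sub>1 \<le> d_X X g\<^sub>2" "L_X X g\<^sub>1 \<le> L_X X g\<^sub>2" "D_X X g\<^sub>1 \<le> D_X X g\<^sub>2"
    and nonneg: "0 \<le> L_X X g\<^sub>1" "0 \<le> D_X X g\<^sub>1"
  shows "C_eps e X g\<^sub>1 \<le> C_eps e X g\<^sub>2"
proof -
  define b where "b g = 1 + D_X X g * sqrt (2 * L_X X g / e)" for g
  have b1: "1 \<le> b g\<^sub>1" using assms by (simp add: b_def)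
  have "sqrt (2 * L_X X g\<^sub>1 / e) \<le> sqrt (2 * L_X X g\<^sub>2 / e)"
    using assms by (simp add: divide_right_mono)
  then have b12: "b g\<^sub>1 \<le> b g\<^sub>2"
    unfolding b_def using assms by (intro add_left_mono mult_mono) auto
  have "b g\<^sub>1 ^ d_X X g\<^sub>1 \<le> b g\<^sub>2 ^ d_X X g\<^sub>1"
    using b1 b12 by (intro power_mono) auto
  also have "\<dots> \<le> b g\<^sub>2 ^ d_X X g\<^sub>2"
    using b1 b12 assms by (intro power_increasing) auto
  finally have "b g\<^sub>1 ^ d_X X g\<^sub>1 \<le> b g\<^sub>2 ^ d_X X g\<^sub>2" .
  \<comment> \<open>The case of dimension 0 merges with the other one because a zeroth power is
    1.\<close>
  moreover have "C_eps e X g = b g ^ d_X X g" for g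
    by (simp add: C_eps_def b_def)
  ultimately show ?thesis by simp
qed

text \<open>The terms \<open>h\<^sub>1 x\<close> and \<open>h\<^sub>2 x\<close> do not depend on
  \<open>i\<close>, so termwise comparison survives the maximum; \<open>1 \<le> m\<close> makes the
  index set nonempty.\<close>

lemma lower_model_mono:
  fixes g\<^sub>1 h\<^sub>1 g\<^sub>2 h\<^sub>2 :: "real^'n \<Rightarrow> real"
  assumes m: "1 \<le> m"
    and le: "\<And>i. i \<in> {1..m} \<Longrightarrow> g\<^sub>2 (a i) + grad g\<^sub>2 (a i) \<bullet> (x - a i) - h\<^sub>2 x
      \<le> g\<^sub>1 (a i) + grad g\<^sub>1 (a i) \<bullet> (x - a i) - h\<^sub>1 x"
  shows "lower_model g\<^sub>2 h\<^sub>2 m a x \<le> lower_model g\<^sub>1 h\<^sub>1 m a x"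
proof -
  let ?T = "\<lambda>g i. g (a i) + grad g (a i) \<bullet> (x - a i)"
  have "Max (?T g\<^sub>2 ` {1..m}) \<le> Max (?T g\<^sub>1 ` {1..m}) - h\<^sub>1 x + h\<^sub>2 x"
  proof (rule Max.boundedI)
    fix s assume "s \<in> ?T g\<^sub>2 ` {1..m}"
    then obtain i where i: "i \<in> {1..m}" "s = ?T g\<^sub>2 i" by blast
    then have "?T g\<^sub>1 i \<le> Max (?T g\<^sub>1 ` {1..m})" by (intro Max_ge) auto
    then show "s \<le> Max (?T g\<^sub>1 ` {1..m}) - h\<^sub>1 x + h\<^sub>2 x" using le[OF i(1)] i(2) by linarith
  qed (use m in auto)
  then show ?thesis by (simp add: lower_model_def)
qed

theorem theorem9p1:
  fixes X :: "(real^'n) set" and f g\<^sub>1 h\<^sub>1 g\<^sub>2 h\<^sub>2 q :: "real^'n \<Rightarrow> real"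
  assumes "compact X" and "affine hull X = UNIV"
    and "C2_near (convex hull X) f"
    and "(g\<^sub>1, h\<^sub>1) \<in> D2 f X" and "(g\<^sub>2, h\<^sub>2) \<in> D2 f X"
    and "\<forall>x\<in>convex hull X. q x = g\<^sub>2 x - g\<^sub>1 x \<and> q x = h\<^sub>2 x - h\<^sub>1 x"
    and "convex_on (convex hull X) q"
    and "C2_near (convex hull X) q"
  shows "V_X X g\<^sub>2 = V_X X g\<^sub>1 + V_X X q \<and>
    d_X X g\<^sub>1 \<le> d_X X g\<^sub>2 \<and> L_X X g\<^sub>1 \<le> L_X X g\<^sub>2 \<and> D_X X g\<^sub>1 \<le> D_X X g\<^sub>2 \<and>
    (\<forall>\<epsilon>>0. C_eps \<epsilon> X g\<^sub>1 \<le> C_eps \<epsilon> X g\<^sub>2) \<and>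
    (\<forall>m\<ge>1. \<forall>a. (\<forall>i\<in>{1..m}. a i \<in> X) \<longrightarrow>
       (\<forall>x\<in>convex hull X. lower_model g\<^sub>1 h\<^sub>1 m a x \<ge> lower_model g\<^sub>2 h\<^sub>2 m a x))"
proof -
  let ?S = "convex hull X"
  have q: "q x = g\<^sub>2 x - g\<^sub>1 x" "q x = h\<^sub>2 x - h\<^sub>1 x" if "x \<in> ?S" for x
    using assms(6) that by blast+
  obtain U where U: "?S \<subseteq> U" "C2_on U g\<^sub>1"
    using assms(4) by (auto simp: D2_def)
  obtain V where V: "?S \<subseteq> V" "C2_on V g\<^sub>2"
    using assms(5) by (auto simp: D2_def)
  obtain W where W: "?S \<subseteq> W" "C2_on W q"
    using assms(8) by (auto simp: C2_near_def)
  have conv: "convex_on ?S g\<^sub>1" "convex_on ?S g\<^sub>2" "convex_on ?S q"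
    using assms(4,5,7) by (auto simp: D2_def)
  have S: "compact ?S" "convex ?S" "affine hull ?S = UNIV"
    using assms(1,2) by (auto simp: compact_convex_hull convex_convex_hull affine_hull_convex_hull)
  have int: "interior ?S \<noteq> {}" by (rule interior_convex_nonempty[OF S(2,3)])
  have "X \<noteq> {}" using assms(2) by auto
  then have ne: "?S \<noteq> {}" by simp
  have grad: "grad q z = grad g\<^sub>2 z - grad g\<^sub>1 z" if "z \<in> ?S" for z
    by (rule grad_diff_on_convex[OF U(2) V(2) W(2) U(1) V(1) W(1) S(2,3) q(1) that])
  have hess: "hess g\<^sub>2 z = hess g\<^sub>1 z + hess q z" if "z \<in> ?S" for z
    using hess_diff_on_convex[OF U(2) V(2) W(2) U(1) V(1) W(1) S(2,3) q(1) that] by simp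
  have sa: "self_adjoint (hess g\<^sub>1 z)" "self_adjoint (hess g\<^sub>2 z)" "self_adjoint (hess q z)"
    if "z \<in> ?S" for z
    using that U V W by (auto intro: self_adjoint_hess)
  have psd: "pos_semidef (hess g\<^sub>1 z)" "pos_semidef (hess q z)" if "z \<in> ?S" for z
    using pos_semidef_hess[OF conv(1) U(2,1) S(1) int that]
      pos_semidef_hess[OF conv(3) W(2,1) S(1) int that] by auto
  have V_sub: "V_X X g\<^sub>1 \<subseteq> V_X X g\<^sub>2"
    by (rule V_X_subset_add[OF hess sa(1) psd])
  have d: "d_X X g\<^sub>1 \<le> d_X X g\<^sub>2"
    unfolding d_X_def using V_sub by (rule dim_subset)
  have cont: "continuous_on ?S (hess g\<^sub>1)" "continuous_on ?S (hess g\<^sub>2)"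
    using U V by (auto simp: C2_on_def intro: continuous_on_subset)
  have bdd: "bdd_above ((\<lambda>z. lambda_max (hess g\<^sub>1 z)) ` ?S)"
      "bdd_above ((\<lambda>z. lambda_max (hess g\<^sub>2 z)) ` ?S)"
    by (intro bdd_above_lambda_max_hess[OF S(1)] cont sa; assumption)+
  have L: "L_X X g\<^sub>1 \<le> L_X X g\<^sub>2"
    unfolding L_X_def
  proof (rule cSUP_mono[OF ne bdd(2)])
    fix z assume z: "z \<in> ?S"
    have "lambda_max (hess g\<^sub>1 z) \<le> lambda_max (hess g\<^sub>2 z)"
      using lambda_max_le_add[of "hess g\<^sub>1 z" "hess q z"] sa[OF z] psd[OF z]
      by (simp add: hess[OF z])
    then show "\<exists>w\<in>?S. lambda_max (hess g\<^sub>1 z) \<le> lambda_max (hess g\<^sub>2 w)" using z by blast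
  qed
  have L_nonneg: "0 \<le> L_X X g\<^sub>1"
  proof -
    obtain z where z: "z \<in> ?S" using ne by blast
    show ?thesis
      unfolding L_X_def using lambda_max_nonneg[OF sa(1)[OF z] psd(1)[OF z]]
      by (rule cSUP_upper2[OF bdd(1) z])
  qed
  have D: "D_X X g\<^sub>1 \<le> D_X X g\<^sub>2"
    unfolding D_X_def using compact_imp_bounded[OF assms(1)]
    by (intro diameter_orth_proj_mono subspace_V_X V_sub)
  have D_nonneg: "0 \<le> D_X X g\<^sub>1"
    unfolding D_X_def using compact_imp_bounded[OF assms(1)]
    by (intro diameter_ge_0 bounded_orth_proj_image subspace_V_X)
  have model: "lower_model g\<^sub>2 h\<^sub>2 m a x \<le> lower_model g\<^sub>1 h\<^sub>1 m a x"
    if "1 \<le> m" and a: "\<forall>i\<in>{1..m}. a i \<in> X" and x: "x \<in> ?S" for m a x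
  proof (rule lower_model_mono[OF \<open>1 \<le> m\<close>])
    fix i assume "i \<in> {1..m}"
    then have ai: "a i \<in> ?S" using a by (simp add: hull_inc)
    \<comment> \<open>Reading \<open>q\<close> as \<open>g\<^sub>2 - g\<^sub>1\<close> at
      \<open>a i\<close> and as \<open>h\<^sub>2 - h\<^sub>1\<close> at \<open>x\<close> turns this
      tangent inequality into the comparison of the two \<open>i\<close>-th terms.\<close>
    then have "q (a i) + grad q (a i) \<bullet> (x - a i) \<le> q x"
      using W by (intro convex_on_tangent_le[OF conv(3) ai x] C2_on_gderiv[of W]) auto
    then show "g\<^sub>2 (a i) + grad g\<^sub>2 (a i) \<bullet> (x - a i) - h\<^sub>2 x
        \<le> g\<^sub>1 (a i) + grad g\<^sub>1 (a i) \<bullet> (x - a i) - h\<^sub>1 x"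
      using grad[OF ai] q(1)[OF ai] q(2)[OF x] by (simp add: inner_diff_left)
  qed
  show ?thesis
    using V_X_add[OF hess sa(1,3) psd] d L D C_eps_mono[OF _ d L D L_nonneg D_nonneg] model
    by simp
qed

end
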